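(* Let $\mathbb{B}(\mathbb{R})$ be the interval algebra over the chain $\mathbb{R}$. For every generating set $G$ of $\mathbb{B}(\mathbb{R})$, the set $\{ p \in \mathrm{Ult}(\mathbb{B}(\mathbb{R})) : |G \cap p| < 2^{\aleph_0} \}$ is nowhere dense in the Stone space $\mathrm{Ult}(\mathbb{B}(\mathbb{R}))$.
   Context: For a chain (linearly ordered set) $C$, the interval algebra $\mathbb{B}(C)$ is the subalgebra of the power set algebra $\mathscr{P}(C)$ generated by all sets $[a,\rightarrow) = \{x \in C : x \geq a\}$, $a \in C$. $\mathrm{Ult}(\mathbb{B})$ denotes the set of ultrafilters of a Boolean algebra $\mathbb{B}$ with the Stone (pointwise) topology. A generating set of a Boolean algebra is a subset that generates it as a Boolean algebra. *)

theory Defs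
  imports "HOL-Analysis.Analysis"
begin

text \<open>
  Boolean algebras are taken as concrete algebras of subsets of a set \<Omega>, in the sense of
  the library locale \<open>algebra \<Omega> B\<close>; the Boolean operations are the set-theoretic ones,
  with zero \<open>{}\<close>, unit \<Omega> and complement \<open>\<Omega> - a\<close>.
\<close>

definition generated_algebra :: "'a set \<Rightarrow> 'a set set \<Rightarrow> 'a set set" where
  "generated_algebra \<Omega> G = (algebra \<Omega>) hull G"

text \<open>The chain is the underlying set of a linearly ordered type; \<open>{a..}\<close> is the ray of all
  \<open>x \<ge> a\<close>.\<close>

definition interval_algebra :: "'a::linorder set set" where
  "interval_algebra = generated_algebra UNIV (range (\<lambda>a. {a..}))"

definition generating_set :: "'a set \<Rightarrow> 'a set set \<Rightarrow> 'a set set \<Rightarrow> bool" where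
  "generating_set \<Omega> B G \<longleftrightarrow> G \<subseteq> B \<and> generated_algebra \<Omega> G = B"

definition proper_filter :: "'a set \<Rightarrow> 'a set set \<Rightarrow> 'a set set \<Rightarrow> bool" where
  "proper_filter \<Omega> B p \<longleftrightarrow>
     p \<subseteq> B \<and> \<Omega> \<in> p \<and> {} \<notin> p \<and>
     (\<forall>a\<in>p. \<forall>b\<in>p. a \<inter> b \<in> p) \<and>
     (\<forall>a\<in>p. \<forall>b\<in>B. a \<subseteq> b \<longrightarrow> b \<in> p)"

definition Ult :: "'a set \<Rightarrow> 'a set set \<Rightarrow> 'a set set set" where
  "Ult \<Omega> B = {p. proper_filter \<Omega> B p \<and> (\<forall>q. proper_filter \<Omega> B q \<and> p \<subseteq> q \<longrightarrow> q = p)}"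

text \<open>Identifying an ultrafilter with its characteristic function on \<open>B\<close>, the sets below (closed
  under complement in \<open>Ult \<Omega> B\<close>) generate the topology of pointwise convergence.\<close>

definition stone_topology :: "'a set \<Rightarrow> 'a set set \<Rightarrow> 'a set set topology" where
  "stone_topology \<Omega> B = topology_generated_by ((\<lambda>a. {p \<in> Ult \<Omega> B. a \<in> p}) ` B)"

definition nowhere_dense_in :: "'a topology \<Rightarrow> 'a set \<Rightarrow> bool" where
  "nowhere_dense_in X S \<longleftrightarrow>
     S \<subseteq> topspace X \<and> X interior_of (X closure_of S) = {}"

end

theory Submission
  imports Defs
begin

text \<open>
  For each real \<open>x\<close>, some member of \<open>G\<close> has \<open>x\<close> as an endpoint, since otherwise \<open>G\<close> would lie
  in the proper subalgebra of those sets that do not change at \<open>x\<close>. If \<open>x\<close> lies in an interval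
  \<open>(a, b)\<close>, such a member contains some rational interval \<open>[r, q)\<close> with \<open>a < r < q < b\<close>. There are
  countably many rational intervals and every member of \<open>G\<close> has finitely many endpoints; as the
  continuum has uncountable cofinality, a single \<open>[r, q)\<close> is contained in continuum many members
  of \<open>G\<close>. All ultrafilters containing that \<open>[r, q)\<close> contain these members of \<open>G\<close>, so every basic
  open set has a nonempty open subset disjoint from the set in question.
\<close>

section \<open>Cofinality of the continuum\<close>

text \<open>Koenig's diagonal argument: a set of naturals is a sequence of sets of naturals, and a
  sequence can be chosen to avoid the \<open>n\<close>-th projection of \<open>A n\<close> for all \<open>n\<close>.\<close>

lemma nat_sets_UN_nat:
  fixes A :: "nat \<Rightarrow> nat set set"
  assumes "(\<Union>n. A n) = UNIV"
  shows "\<exists>n. (UNIV :: nat set set) \<lesssim> A n"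
proof (rule ccontr)
  assume none: "\<nexists>n. (UNIV :: nat set set) \<lesssim> A n"
  define section_at where "section_at n Y = {k. prod_encode (n, k) \<in> Y}" for n and Y :: "nat set"
  have "\<exists>y. y \<notin> section_at n ` A n" for n
    using none subset_image_lepoll[of UNIV "section_at n" "A n"] by blast
  then obtain y where y: "\<And>n. y n \<notin> section_at n ` A n"
    by metis
  define Y where "Y = {prod_encode (n, k) | n k. k \<in> y n}"
  have "section_at n Y = y n" for n
    by (auto simp: section_at_def Y_def)
  moreover obtain n where "Y \<in> A n"
    using assms by blast
  ultimately show False
    using y by blast
qed

text \<open>A map \<open>f\<close> from the union onto all sets of naturals turns the
  \<open>A i\<close> into images that cover \<open>UNIV\<close>. Listing \<open>I\<close> as a
  sequence then reduces the claim to the diagonal argument.\<close>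

lemma nat_sets_lepoll_countable_UN:
  assumes "countable I" and "(UNIV :: nat set set) \<lesssim> (\<Union>i\<in>I. A i)"
  shows "\<exists>i\<in>I. (UNIV :: nat set set) \<lesssim> A i"
proof -
  from assms(2) obtain f where f: "(UNIV :: nat set set) \<subseteq> f ` (\<Union>i\<in>I. A i)"
    by (auto simp: lepoll_iff)
  then have "I \<noteq> {}"
    by auto
  have "(\<Union>n. f ` A (from_nat_into I n)) = UNIV"
  proof -
    have "(\<Union>n. A (from_nat_into I n)) = (\<Union>i\<in>I. A i)"
      using arg_cong[OF range_from_nat_into[OF \<open>I \<noteq> {}\<close> assms(1)], of "\<lambda>J. \<Union>i\<in>J. A i"]
      by simp
    then have "(\<Union>n. f ` A (from_nat_into I n)) = f ` (\<Union>i\<in>I. A i)"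
      by (metis image_UN)
    then show ?thesis
      using f by (simp add: top.extremum_unique)
  qed
  then obtain n where "(UNIV :: nat set set) \<lesssim> f ` A (from_nat_into I n)"
    using nat_sets_UN_nat by blast
  then have "(UNIV :: nat set set) \<lesssim> A (from_nat_into I n)"
    using image_lepoll lepoll_trans by blast
  then show ?thesis
    using from_nat_into[OF \<open>I \<noteq> {}\<close>] by blast
qed

text \<open>Taking the \<open>n\<close>-th element of each \<open>F x\<close> gives an image of
  \<open>A\<close>. Countably many such images cover the union, so one of them already has at least
  the size of the continuum.\<close>

lemma nat_sets_lepoll_UN_finite:
  assumes "(UNIV :: nat set set) \<lesssim> (\<Union>x\<in>A. F x)" and "\<And>x. x \<in> A \<Longrightarrow> finite (F x)"
  shows "(UNIV :: nat set set) \<lesssim> A"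
proof -
  \<comment> \<open>An inclusion is enough: where \<open>F x\<close> is empty,
    \<open>from_nat_into\<close> has an unspecified value, which may add stray elements on the
    right.\<close>
  have "(\<Union>x\<in>A. F x) \<subseteq> (\<Union>n. (\<lambda>x. from_nat_into (F x) n) ` A)"
  proof
    fix y assume "y \<in> (\<Union>x\<in>A. F x)"
    then obtain x where x: "x \<in> A" "y \<in> F x"
      by blast
    then have "from_nat_into (F x) (to_nat_on (F x) y) = y"
      using assms(2) by (simp add: countable_finite)
    with x(1) show "y \<in> (\<Union>n. (\<lambda>x. from_nat_into (F x) n) ` A)"
      by (metis UN_I UNIV_I image_eqI)
  qed
  then have "(UNIV :: nat set set) \<lesssim> (\<Union>n. (\<lambda>x. from_nat_into (F x) n) ` A)"
    using assms(1) lepoll_trans subset_imp_lepoll by blast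
  then obtain n where "(UNIV :: nat set set) \<lesssim> (\<lambda>x. from_nat_into (F x) n) ` A"
    using nat_sets_lepoll_countable_UN[OF countableI_type] by blast
  then show ?thesis
    using image_lepoll lepoll_trans by blast
qed

lemma nat_sets_lepoll_open_interval:
  fixes a b :: real
  assumes "a < b"
  shows "(UNIV :: nat set set) \<lesssim> {a<..<b}"
  using open_interval_eqpoll_reals[of a b] nat_sets_eqpoll_reals assms
  by (meson eqpoll_imp_lepoll eqpoll_sym lepoll_trans)

section \<open>Generated algebras of sets\<close>

lemma algebra_Inter:
  assumes "\<And>A. A \<in> \<A> \<Longrightarrow> algebra UNIV A"
  shows "algebra UNIV (\<Inter>\<A>)"
  using assms by (auto simp: algebra_iff_Un)

lemma algebra_generated_algebra: "algebra UNIV (generated_algebra UNIV G)"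
  unfolding generated_algebra_def by (rule hull_in) (simp add: algebra_Inter)

lemma generated_algebra_least:
  assumes "algebra UNIV A" and "G \<subseteq> A"
  shows "generated_algebra UNIV G \<subseteq> A"
  unfolding generated_algebra_def using assms by (simp add: hull_minimal)

lemma algebra_interval_algebra: "algebra UNIV interval_algebra"
  by (simp add: interval_algebra_def algebra_generated_algebra)

lemma atLeast_in_interval_algebra: "{a..} \<in> interval_algebra"
  unfolding interval_algebra_def generated_algebra_def by (rule hull_inc) simp

lemma atLeastLessThan_in_interval_algebra: "{a..<b} \<in> interval_algebra"
proof -
  interpret algebra UNIV "interval_algebra :: 'a set set"
    by (rule algebra_interval_algebra)
  have "{a..<b} = {a..} - {b..}"
    by auto
  then show ?thesis
    by (simp add: Diff atLeast_in_interval_algebra)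
qed

text \<open>Complementary sets share their frontier, and the frontier of a union lies in the union
  of the frontiers, so every ideal \<open>P\<close> of sets yields an algebra. Below,
  \<open>P\<close> is finiteness or the avoidance of a point.\<close>

lemma algebra_frontier:
  assumes "P {}" and "\<And>S T. P S \<Longrightarrow> P T \<Longrightarrow> P (S \<union> T)" and "\<And>S T. P T \<Longrightarrow> S \<subseteq> T \<Longrightarrow> P S"
  shows "algebra UNIV {b. P (frontier b)}"
proof (unfold algebra_iff_Un, intro conjI ballI)
  fix a b :: "'a set"
  assume "a \<in> {b. P (frontier b)}" "b \<in> {b. P (frontier b)}"
  then show "a \<union> b \<in> {b. P (frontier b)}"
    using assms(2,3) frontier_Un_subset by (metis mem_Collect_eq)
qed (use assms(1) in \<open>auto simp: Compl_eq_Diff_UNIV[symmetric]\<close>)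

lemma finite_frontier_interval_algebra:
  fixes b :: "real set"
  assumes "b \<in> interval_algebra"
  shows "finite (frontier b)"
proof -
  have "interval_algebra \<subseteq> {b :: real set. finite (frontier b)}"
    unfolding interval_algebra_def
    by (intro generated_algebra_least algebra_frontier)
      (auto intro: finite_subset)
  with assms show ?thesis
    by blast
qed

text \<open>The sets whose frontier avoids \<open>x\<close> form an algebra. It cannot include
  \<open>G\<close>, as it misses the ray \<open>{x..}\<close>.\<close>

lemma generating_set_endpoint:
  fixes G :: "real set set"
  assumes "generating_set UNIV interval_algebra G"
  shows "\<exists>g\<in>G. x \<in> frontier g"
proof (rule ccontr)
  assume "\<not> ?thesis"
  then have "generated_algebra UNIV G \<subseteq> {b. x \<notin> frontier b}"
    by (intro generated_algebra_least algebra_frontier) auto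
  moreover have "{x..} \<in> generated_algebra UNIV G"
    using assms atLeast_in_interval_algebra by (auto simp: generating_set_def)
  ultimately show False
    by auto
qed

text \<open>Being constant on some \<open>{x..<y}\<close> for every \<open>x\<close> survives unions
  and complements, and rays have this property because they contain their left endpoints.\<close>

lemma interval_algebra_right_open:
  fixes b :: "real set"
  assumes "b \<in> interval_algebra" and "x \<in> b"
  shows "\<exists>y>x. {x..<y} \<subseteq> b"
proof -
  let ?A = "{b. \<forall>x. \<exists>y>x. {x..<y} \<subseteq> b \<or> {x..<y} \<subseteq> - b} :: real set set"
  have "algebra UNIV ?A"
  proof (unfold algebra_iff_Un, intro conjI ballI)
    fix a b assume ab: "a \<in> ?A" "b \<in> ?A"
    have "\<exists>y>x. {x..<y} \<subseteq> a \<union> b \<or> {x..<y} \<subseteq> - (a \<union> b)" for x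
    proof -
      from ab obtain y z where "y > x" "{x..<y} \<subseteq> a \<or> {x..<y} \<subseteq> - a"
        and "z > x" "{x..<z} \<subseteq> b \<or> {x..<z} \<subseteq> - b"
        by blast
      moreover have "{x..<min y z} = {x..<y} \<inter> {x..<z}"
        by auto
      ultimately show ?thesis
        by (intro exI[of _ "min y z"] conjI) (simp, blast)
    qed
    then show "a \<union> b \<in> ?A"
      by blast
  next
    fix a assume "a \<in> ?A"
    then show "UNIV - a \<in> ?A"
      by (simp add: Compl_eq_Diff_UNIV[symmetric]) metis
  qed (auto intro: gt_ex)
  moreover have "{a..} \<in> ?A" for a
  proof -
    have "\<exists>y>x. {x..<y} \<subseteq> {a..} \<or> {x..<y} \<subseteq> - {a..}" for x
    proof (cases "a \<le> x")
      case True
      then have "{x..<x + 1} \<subseteq> {a..}"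
        by auto
      then show ?thesis
        by (intro exI[of _ "x + 1"]) simp
    next
      case False
      then show ?thesis
        by (intro exI[of _ a]) auto
    qed
    then show ?thesis
      by blast
  qed
  ultimately have "interval_algebra \<subseteq> ?A"
    unfolding interval_algebra_def by (intro generated_algebra_least) auto
  with assms(1) obtain y where "y > x" "{x..<y} \<subseteq> b \<or> {x..<y} \<subseteq> - b"
    by blast
  \<comment> \<open>The point \<open>x\<close> lies both in \<open>{x..<y}\<close> and in
    \<open>b\<close>, which excludes the second alternative.\<close>
  with assms(2) show ?thesis
    by (metis ComplD atLeastLessThan_iff order_refl subsetD)
qed

section \<open>The Stone space\<close>

text \<open>A proper filter above this one cannot contain a set missing \<open>x\<close>, as it
  already contains the complement. These ultrafilters witness that nonempty members of
  \<open>B\<close> have nonempty basic open sets.\<close>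

lemma principal_ultrafilter:
  assumes "algebra \<Omega> B" and "x \<in> \<Omega>"
  shows "{b \<in> B. x \<in> b} \<in> Ult \<Omega> B"
proof -
  interpret algebra \<Omega> B by fact
  let ?p = "{b \<in> B. x \<in> b}"
  have "proper_filter \<Omega> B ?p"
    using assms(2) by (auto simp: proper_filter_def)
  moreover have "q = ?p" if q: "proper_filter \<Omega> B q" "?p \<subseteq> q" for q
  proof -
    have "x \<in> b" if "b \<in> q" for b
    proof (rule ccontr)
      assume "x \<notin> b"
      moreover have "b \<in> B"
        using q(1) that by (auto simp: proper_filter_def)
      ultimately have "\<Omega> - b \<in> q"
        using q(2) assms(2) by auto
      then have "b \<inter> (\<Omega> - b) \<in> q"
        using q(1) that unfolding proper_filter_def by blast
      then show False
        using q(1) by (simp add: proper_filter_def)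
    qed
    with q show ?thesis
      by (auto simp: proper_filter_def)
  qed
  ultimately show ?thesis
    by (simp add: Ult_def)
qed

lemma topspace_stone_topology:
  assumes "algebra \<Omega> B"
  shows "topspace (stone_topology \<Omega> B) = Ult \<Omega> B"
proof -
  have "\<Omega> \<in> B"
    using assms by (simp add: algebra.top)
  moreover have "\<Omega> \<in> p" if "p \<in> Ult \<Omega> B" for p
    using that by (simp add: Ult_def proper_filter_def)
  ultimately show ?thesis
    unfolding stone_topology_def by auto
qed

lemma openin_stone_topology_basic:
  "a \<in> B \<Longrightarrow> openin (stone_topology \<Omega> B) {p \<in> Ult \<Omega> B. a \<in> p}"
  unfolding stone_topology_def by (rule topology_generated_by_Basis) simp

text \<open>The generating open sets already form a basis, since a filter contains
  \<open>a \<inter> b\<close> exactly if it contains both \<open>a\<close> and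
  \<open>b\<close>.\<close>

lemma stone_topology_basis:
  assumes "algebra \<Omega> B" and "openin (stone_topology \<Omega> B) U" and "p \<in> U"
  shows "\<exists>a\<in>p. a \<in> B \<and> {p \<in> Ult \<Omega> B. a \<in> p} \<subseteq> U"
proof -
  interpret algebra \<Omega> B by fact
  have filter: "proper_filter \<Omega> B q" if "q \<in> Ult \<Omega> B" for q
    using that by (simp add: Ult_def)
  have "p \<in> Ult \<Omega> B"
    using openin_subset[OF assms(2)] assms(3) topspace_stone_topology[OF assms(1)] by auto
  have "generate_topology_on ((\<lambda>a. {p \<in> Ult \<Omega> B. a \<in> p}) ` B) U"
    using assms(2) unfolding stone_topology_def by (rule openin_topology_generated_by)
  then show ?thesis
    using assms(3)
  proof induction
    case (Int U V)
    then obtain a b where ab: "a \<in> p" "a \<in> B" "{p \<in> Ult \<Omega> B. a \<in> p} \<subseteq> U"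
      "b \<in> p" "b \<in> B" "{p \<in> Ult \<Omega> B. b \<in> p} \<subseteq> V"
      by blast
    have "a \<in> q \<and> b \<in> q" if "q \<in> Ult \<Omega> B" "a \<inter> b \<in> q" for q
      using filter[OF that(1)] that(2) ab(2,5) unfolding proper_filter_def by (meson inf_le1 inf_le2)
    moreover have "a \<inter> b \<in> p"
      using filter[OF \<open>p \<in> Ult \<Omega> B\<close>] ab(1,4) by (simp add: proper_filter_def)
    ultimately show ?case
      using ab by (intro bexI[of _ "a \<inter> b"]) auto
  next
    case (UN K)
    then show ?case
      by (meson Union_iff Union_upper order_trans)
  qed auto
qed

text \<open>The basic open set of \<open>c\<close> misses \<open>S\<close> and hence its closure. An
  interior point of the closure would put the basic open set of some nonempty \<open>b\<close>, and
  with it the nonempty one of \<open>c\<close>, inside the closure.\<close>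

lemma nowhere_dense_in_stone_topology:
  assumes "algebra \<Omega> B" and "S \<subseteq> Ult \<Omega> B"
    and "\<And>b. b \<in> B \<Longrightarrow> b \<noteq> {} \<Longrightarrow> \<exists>c\<in>B. c \<noteq> {} \<and> c \<subseteq> b \<and> (\<forall>p\<in>S. c \<notin> p)"
  shows "nowhere_dense_in (stone_topology \<Omega> B) S"
proof -
  let ?X = "stone_topology \<Omega> B"
  have "?X interior_of (?X closure_of S) = {}"
  proof (rule ccontr)
    assume "?X interior_of (?X closure_of S) \<noteq> {}"
    then obtain p where p: "p \<in> ?X interior_of (?X closure_of S)"
      by blast
    then obtain b where b: "b \<in> p" "b \<in> B"
      and sub: "{p \<in> Ult \<Omega> B. b \<in> p} \<subseteq> ?X interior_of (?X closure_of S)"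
      using stone_topology_basis[OF assms(1) openin_interior_of] by blast
    have "p \<in> Ult \<Omega> B"
      using p interior_of_subset_topspace[of ?X] topspace_stone_topology[OF assms(1)] by auto
    with b have "b \<noteq> {}"
      by (auto simp: Ult_def proper_filter_def)
    then obtain c where c: "c \<in> B" "c \<noteq> {}" "c \<subseteq> b" "\<forall>p\<in>S. c \<notin> p"
      using assms(3) b(2) by blast
    then obtain x where "x \<in> c"
      by blast
    moreover have "x \<in> \<Omega>"
      using assms(1) c(1) \<open>x \<in> c\<close> by (auto simp: algebra_iff_Un)
    ultimately have "{b \<in> B. x \<in> b} \<in> {p \<in> Ult \<Omega> B. c \<in> p}"
      and "{b \<in> B. x \<in> b} \<in> {p \<in> Ult \<Omega> B. b \<in> p}"
      using principal_ultrafilter[OF assms(1)] b(2) c(1,3) by auto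
    moreover have "{p \<in> Ult \<Omega> B. b \<in> p} \<subseteq> ?X closure_of S"
      using sub interior_of_subset by (rule order_trans)
    moreover have "{p \<in> Ult \<Omega> B. c \<in> p} \<inter> ?X closure_of S = {}"
      using openin_Int_closure_of_eq_empty[OF openin_stone_topology_basic[OF c(1)]] c(4) by blast
    ultimately show False
      by blast
  qed
  with assms(2) show ?thesis
    by (simp add: nowhere_dense_in_def topspace_stone_topology[OF assms(1)])
qed

section \<open>Generating sets of the interval algebra\<close>

text \<open>An endpoint \<open>x\<close> need not belong to \<open>g\<close> but lies in its
  closure, so \<open>g\<close> meets \<open>{a<..<b}\<close> in some \<open>y\<close> and contains
  an interval starting there.\<close>

lemma generating_set_contains_rational_interval:
  fixes a b x :: real
  assumes "generating_set UNIV interval_algebra G" and "a < x" "x < b"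
  shows "\<exists>g\<in>G. \<exists>r\<in>\<rat>. \<exists>q\<in>\<rat>. x \<in> frontier g \<and> a < r \<and> r < q \<and> q < b \<and> {r..<q} \<subseteq> g"
proof -
  obtain g where g: "g \<in> G" "x \<in> frontier g"
    using generating_set_endpoint[OF assms(1)] by blast
  then have "g \<in> interval_algebra"
    using assms(1) by (auto simp: generating_set_def)
  have "x \<in> closure g"
    using g(2) by (simp add: frontier_def)
  then have "{a<..<b} \<inter> g \<noteq> {}"
    using assms(2,3) open_Int_closure_eq_empty[of "{a<..<b}" g] by auto
  then obtain y where y: "a < y" "y < b" "y \<in> g"
    by auto
  then obtain z where z: "y < z" "{y..<z} \<subseteq> g"
    using interval_algebra_right_open[OF \<open>g \<in> interval_algebra\<close>] by blast
  \<comment> \<open>The bound \<open>min z b\<close> keeps the rational interval inside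
    \<open>{y..<z}\<close> and below \<open>b\<close> at once.\<close>
  obtain r where r: "r \<in> \<rat>" "y < r" "r < min z b"
    using Rats_dense_in_real[of y "min z b"] y z by auto
  obtain q where q: "q \<in> \<rat>" "r < q" "q < min z b"
    using Rats_dense_in_real[OF r(3)] by auto
  have "{r..<q} \<subseteq> {y..<z}"
    using r q by auto
  with g r q y z show ?thesis
    by (intro bexI[of _ g] bexI[of _ r] bexI[of _ q]) auto
qed

lemma generating_set_many_supersets:
  fixes a b :: real
  assumes gen: "generating_set UNIV interval_algebra G" and "a < b"
  shows "\<exists>r q. a < r \<and> r < q \<and> q < b \<and> (UNIV :: nat set set) \<lesssim> {g \<in> G. {r..<q} \<subseteq> g}"
proof -
  define I where "I = {(r, q). r \<in> \<rat> \<and> q \<in> \<rat> \<and> a < r \<and> r < q \<and> q < b}"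
  define M where "M = (\<lambda>(r, q). {g \<in> G. {r..<q} \<subseteq> g})"
  have "countable I"
    by (rule countable_subset[of _ "\<rat> \<times> \<rat>"]) (auto simp: I_def countable_rat)
  \<comment> \<open>The frontier points are grouped by the rational interval that the set contains,
    so that one of countably many groups must have continuum many of them.\<close>
  have "x \<in> (\<Union>i\<in>I. \<Union>g\<in>M i. frontier g)" if "x \<in> {a<..<b}" for x
    using that generating_set_contains_rational_interval[OF gen, of a x b]
    by (fastforce simp: I_def M_def)
  then have "(UNIV :: nat set set) \<lesssim> (\<Union>i\<in>I. \<Union>g\<in>M i. frontier g)"
    using nat_sets_lepoll_open_interval[OF \<open>a < b\<close>]
    by (meson lepoll_trans subsetI subset_imp_lepoll)
  then obtain i where "i \<in> I" and i: "(UNIV :: nat set set) \<lesssim> (\<Union>g\<in>M i. frontier g)"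
    using nat_sets_lepoll_countable_UN[OF \<open>countable I\<close>] by blast
  have "finite (frontier g)" if "g \<in> M i" for g
    using that gen finite_frontier_interval_algebra
    by (auto simp: M_def generating_set_def split: prod.splits)
  with i have "(UNIV :: nat set set) \<lesssim> M i"
    by (rule nat_sets_lepoll_UN_finite)
  with \<open>i \<in> I\<close> show ?thesis
    by (auto simp: I_def M_def)
qed

theorem proposition1p2:
  fixes G :: "real set set"
  assumes "generating_set UNIV (interval_algebra :: real set set) G"
  shows "nowhere_dense_in
           (stone_topology UNIV (interval_algebra :: real set set))
           {p \<in> Ult UNIV (interval_algebra :: real set set).
              G \<inter> p \<prec> (UNIV :: nat set set)}"
proof (rule nowhere_dense_in_stone_topology[OF algebra_interval_algebra])
  fix b :: "real set" assume b: "b \<in> interval_algebra" "b \<noteq> {}"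
  then obtain x y where "x < y" and xy: "{x..<y} \<subseteq> b"
    using interval_algebra_right_open[OF b(1)] by blast
  from \<open>x < y\<close> obtain r q where rq: "x < r" "r < q" "q < y"
    and many: "(UNIV :: nat set set) \<lesssim> {g \<in> G. {r..<q} \<subseteq> g}"
    using generating_set_many_supersets[OF assms, of x y] by blast
  \<comment> \<open>Upward closure puts into \<open>p\<close> all the continuum many members of
    \<open>G\<close> that include \<open>{r..<q}\<close>.\<close>
  have "\<not> G \<inter> p \<prec> (UNIV :: nat set set)"
    if "p \<in> Ult UNIV interval_algebra" "{r..<q} \<in> p" for p
  proof -
    have "proper_filter UNIV interval_algebra p"
      using that(1) by (simp add: Ult_def)
    then have "{g \<in> G. {r..<q} \<subseteq> g} \<subseteq> G \<inter> p"
      using that(2) assms unfolding proper_filter_def generating_set_def by blast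
    then have "(UNIV :: nat set set) \<lesssim> G \<inter> p"
      using many lepoll_trans subset_imp_lepoll by blast
    then show ?thesis
      using lesspoll_trans1 lesspoll_not_refl by blast
  qed
  moreover have "{r..<q} \<subseteq> b"
    using xy rq by (auto intro!: subsetD[OF xy])
  ultimately show "\<exists>c\<in>interval_algebra. c \<noteq> {} \<and> c \<subseteq> b \<and>
      (\<forall>p\<in>{p \<in> Ult UNIV interval_algebra. G \<inter> p \<prec> (UNIV :: nat set set)}. c \<notin> p)"
    using \<open>r < q\<close> atLeastLessThan_in_interval_algebra[of r q] by (intro bexI[of _ "{r..<q}"]) auto
qed auto

end
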